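(* Define $a(1)=1$ and $a(n)=1+\sum_m a(m)$ for $n>1$, the sum over all proper divisors $m$ of $n$ (positive divisors $m<n$). Let $p,q,r$ be distinct primes and $c,d,e$ nonnegative integers. Then $$a(p^c)=2^c,\qquad a(p^cq^d)=2^c\sum_{i=0}^{d}\binom{d}{i}\binom{c+i}{i},$$ $$a(p^cq^dr^e)=\sum_{j=0}^{d}(-1)^j\binom{d}{j}\binom{c+d-j}{d}\,a(p^{c+d-j}r^e).$$
   Context: $a(n)$ is called the number of recursive divisors of $n$. *)

theory Defs
  imports "HOL-Computational_Algebra.Primes"
begin

text \<open>The number of recursive divisors of a positive integer. The value at 0 is a dummy.\<close>

fun recursive_divisors :: "nat \<Rightarrow> nat" where
  "recursive_divisors n =
     (if n = 0 then 0
      else if n = 1 then 1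
      else 1 + (\<Sum>m | 0 < m \<and> m dvd n \<and> m < n. recursive_divisors m))"

declare recursive_divisors.simps [simp del]

end

(*
  Since 2 a(n) = 1 + (sum of a(m) over all divisors m of n), the function G c d = a(p^c q^d)
  satisfies v G(c, d) = 1 + (sum of G(i, j) over i <= c, j <= d) with v = 2. A further prime r is
  absorbed into the coefficient ring: the power series G c d with coefficients a(p^c q^d r^e), e >= 0,
  satisfy the same equation with v = 2 (1 - X), because multiplying by 1 - X undoes the summation
  over e. Taking differences in c and d gives a local recurrence that determines G over any
  integral domain with v \<noteq> 1, and the closed forms satisfy it by Pascal's rule.
*)
theory Submission
  imports Defs "HOL-Computational_Algebra.Formal_Power_Series"
begin

text \<open>Multiplication maps pairs of divisors onto the divisors of \<open>a * b\<close>.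
  Coprimality makes it injective: in \<open>x * y = x' * y'\<close>, \<open>x\<close> is coprime to
  \<open>y'\<close> and \<open>x'\<close> to \<open>y\<close>, which forces \<open>x = x'\<close>
  and \<open>y = y'\<close>.\<close>

lemma sum_divisors_mult_coprime:
  fixes f :: "nat \<Rightarrow> 'a::comm_monoid_add"
  assumes "coprime a b"
  shows "(\<Sum>m | m dvd a * b. f m) = (\<Sum>x | x dvd a. \<Sum>y | y dvd b. f (x * y))"
proof -
  have inj: "inj_on (\<lambda>(x, y). x * y) ({x. x dvd a} \<times> {y. y dvd b})"
  proof (clarsimp simp: inj_on_def)
    fix x y x' y'
    assume "x dvd a" "y dvd b" "x' dvd a" "y' dvd b" and eq: "x * y = x' * y'"
    then have "coprime x y'" "coprime x' y"
      using assms coprime_divisors by blast+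
    then show "x = x' \<and> y = y'"
      using eq coprime_crossproduct_nat[of x y' x' y] by (simp add: mult.commute)
  qed
  have img: "(\<lambda>(x, y). x * y) ` ({x. x dvd a} \<times> {y. y dvd b}) = {m. m dvd a * b}"
    by (auto simp: image_iff intro: mult_dvd_mono elim!: dvd_productE)
  show ?thesis
    unfolding sum.cartesian_product img[symmetric] sum.reindex[OF inj]
    by (simp add: case_prod_unfold)
qed

lemma sum_divisors_prime_power:
  fixes p :: nat and f :: "nat \<Rightarrow> 'a::comm_monoid_add"
  assumes "prime p"
  shows "(\<Sum>m | m dvd p ^ c. f m) = (\<Sum>i\<le>c. f (p ^ i))"
proof -
  have "{m. m dvd p ^ c} = (\<lambda>i. p ^ i) ` {..c}"
    using divides_primepow_nat[OF assms] by auto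
  moreover have "inj_on (\<lambda>i. p ^ i) {..c}"
    using assms by (auto simp: inj_on_def prime_gt_Suc_0_nat)
  ultimately show ?thesis
    by (simp add: sum.reindex)
qed

lemma double_recursive_divisors:
  assumes "n > 0"
  shows "2 * recursive_divisors n = 1 + (\<Sum>m | m dvd n. recursive_divisors m)"
proof (cases "n = 1")
  case True
  then show ?thesis by (simp add: recursive_divisors.simps)
next
  case False
  have "{m. m dvd n} = insert n {m. 0 < m \<and> m dvd n \<and> m < n}"
    using assms by (auto dest: dvd_imp_le intro: Nat.gr0I)
  moreover have "recursive_divisors n =
      1 + (\<Sum>m | 0 < m \<and> m dvd n \<and> m < n. recursive_divisors m)"
    using assms False by (subst recursive_divisors.simps) simp
  ultimately show ?thesis by simp
qed

context
  fixes v :: "'a::idom" and G :: "nat \<Rightarrow> nat \<Rightarrow> 'a"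
  assumes v: "v \<noteq> 1"
    and G: "\<And>c d. v * G c d = 1 + (\<Sum>i\<le>c. \<Sum>j\<le>d. G i j)"
begin

lemma box_sum_diff_left: "v * (G (Suc c) 0 - G c 0) = G (Suc c) 0"
  using G[of "Suc c" 0] G[of c 0] by (simp add: algebra_simps)

lemma box_sum_diff_right: "v * (G 0 (Suc d) - G 0 d) = G 0 (Suc d)"
  using G[of 0 "Suc d"] G[of 0 d] by (simp add: algebra_simps)

text \<open>Inclusion-exclusion over the four corners of a unit square cancels the constant 1 and
  every term of the double sums except the one at \<open>(Suc c, Suc d)\<close>.\<close>

lemma box_sum_diff_both:
  "v * (G (Suc c) (Suc d) - G c (Suc d) - G (Suc c) d + G c d) = G (Suc c) (Suc d)"
  using G[of "Suc c" "Suc d"] G[of c "Suc d"] G[of "Suc c" d] G[of c d]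
  by (simp add: algebra_simps sum.distrib)

lemma box_sum_cancel: "x = y" if "v * (x - z) = x" "v * (y - z) = y"
proof -
  have "(v - 1) * (x - y) = 0" using that by (simp add: algebra_simps)
  then show ?thesis using v by simp
qed

text \<open>Both edges of the grid start at \<open>G 0 0\<close> and obey the same first-order
  recurrence. Hence the values \<open>G d 0\<close> alone can serve as boundary data for both
  edges.\<close>

lemma box_sum_symmetric: "G 0 d = G d 0"
proof (induction d)
  case (Suc d)
  then show ?case
    using box_sum_cancel[of _ "G d 0"] box_sum_diff_left box_sum_diff_right by metis
qed simp

text \<open>By \<open>box_sum_cancel\<close>, the recurrence fixes the far corner of each unit
  square once the combination \<open>?z\<close> of the other three corners is known, so induction
  spreads agreement from the two edges over the grid.\<close>

lemma box_sum_unique: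
  assumes left: "\<And>c. F c 0 = G c 0" and right: "\<And>d. F 0 d = G d 0"
    and both: "\<And>c d. v * (F (Suc c) (Suc d) - F c (Suc d) - F (Suc c) d + F c d)
                 = F (Suc c) (Suc d)"
  shows "F c d = G c d"
proof (induction c arbitrary: d)
  case 0
  then show ?case by (simp add: right box_sum_symmetric)
next
  case (Suc c)
  show ?case
  proof (induction d)
    case 0
    then show ?case by (simp add: left)
  next
    case (Suc d)
    let ?z = "G c (Suc d) + G (Suc c) d - G c d"
    have "v * (F (Suc c) (Suc d) - ?z) = F (Suc c) (Suc d)"
      using both[of c d] Suc \<open>\<And>d. F c d = G c d\<close> by (simp add: algebra_simps)
    moreover have "v * (G (Suc c) (Suc d) - ?z) = G (Suc c) (Suc d)"
      using box_sum_diff_both[of c d] by (simp add: algebra_simps)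
    ultimately show ?case by (rule box_sum_cancel)
  qed
qed

text \<open>
  The coefficient of \<open>G (c + i) 0\<close> below is that of \<open>x ^ c * y ^ d\<close> in
  \<open>(x + y - x * y) ^ (c + i)\<close>.
\<close>

lemma box_sum_expansion:
  "G c d = (\<Sum>i\<le>d. (-1) ^ (d + i) * of_nat (d choose i) * of_nat ((c + i) choose d) * G (c + i) 0)"
proof -
  define K :: "nat \<Rightarrow> nat \<Rightarrow> nat \<Rightarrow> 'a"
    where "K c d i = (-1) ^ (d + i) * of_nat (d choose i) * of_nat ((c + i) choose d)" for c d i
  define F where "F c d = (\<Sum>i\<le>d. K c d i * G (c + i) 0)" for c d
  \<comment> \<open>These two recurrences compare coefficients after one factor
    \<open>x + y - x * y\<close> is split off from the power. For index 0 the middle contribution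
    vanishes.\<close>
  have K0: "K (Suc c) (Suc d) 0 = K c (Suc d) 0 - K c d 0" for c d
    by (simp add: K_def algebra_simps)
  have KSuc: "K (Suc c) (Suc d) (Suc i) = K c (Suc d) (Suc i) + K (Suc c) d i - K c d (Suc i)"
    for c d i
    by (simp add: K_def algebra_simps)
  \<comment> \<open>The added summand is zero because \<open>d choose Suc d = 0\<close>; it aligns
    the range with that of \<open>F c (Suc d)\<close>.\<close>
  have Fd: "F c d = (\<Sum>i\<le>Suc d. K c d i * G (c + i) 0)" for c d
    by (simp add: F_def K_def binomial_eq_0)
  have "F c d = G c d"
  proof (rule box_sum_unique)
    show "F c 0 = G c 0" for c by (simp add: F_def K_def)
    show "F 0 d = G d 0" for d
    proof -
      have "F 0 d = (\<Sum>i\<le>d. if i = d then G d 0 else 0)"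
        unfolding F_def by (intro sum.cong) (auto simp: K_def binomial_eq_0 simp flip: mult_2)
      then show ?thesis by simp
    qed
    fix c d
    \<comment> \<open>The three known corners combine to the weights of
      \<open>F (Suc c) (Suc d)\<close>, with every \<open>G (Suc c + i) 0\<close> replaced by its
      predecessor \<open>G (c + i) 0\<close>. The two-dimensional recurrence thus reduces termwise
      to \<open>box_sum_diff_left\<close>.\<close>
    have "F c (Suc d) + F (Suc c) d - F c d = (\<Sum>i\<le>Suc d. K (Suc c) (Suc d) i * G (c + i) 0)"
      unfolding F_def[of c "Suc d"] F_def[of "Suc c" d] Fd[of c d] sum.atMost_Suc_shift K0 KSuc
      by (simp add: algebra_simps sum.distrib sum_subtractf)
    then have "v * (F (Suc c) (Suc d) - F c (Suc d) - F (Suc c) d + F c d)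
        = (\<Sum>i\<le>Suc d. K (Suc c) (Suc d) i * (v * (G (Suc c + i) 0 - G (c + i) 0)))"
      unfolding F_def[of "Suc c" "Suc d"]
      by (simp add: algebra_simps sum_subtractf sum_distrib_left del: sum.atMost_Suc)
    also have "\<dots> = F (Suc c) (Suc d)"
      unfolding F_def by (simp only: add_Suc box_sum_diff_left)
    finally show "v * (F (Suc c) (Suc d) - F c (Suc d) - F (Suc c) d + F c d)
        = F (Suc c) (Suc d)" .
  qed
  then show ?thesis by (simp add: F_def K_def)
qed

end

text \<open>This is the recurrence of \<open>box_sum_unique\<close> for \<open>v = 2\<close> and
  \<open>F c d = 2 ^ c * S c d\<close>, divided by \<open>2 ^ Suc c\<close>.\<close>

lemma binomial_sum_recurrence:
  defines "S \<equiv> \<lambda>c d. \<Sum>i\<le>d. int (d choose i) * int ((c + i) choose i)"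
  shows "S (Suc c) (Suc d) + S c d = S c (Suc d) + 2 * S (Suc c) d"
proof -
  have Sd: "S c d = (\<Sum>i\<le>Suc d. int (d choose i) * int ((c + i) choose i))" for c
    by (simp add: S_def)
  have S': "S (Suc c) d = (\<Sum>i\<le>d. int (d choose i) * int (Suc (c + i) choose i))"
    by (simp add: S_def)
  \<comment> \<open>Pascal's rule applied to both factors of \<open>S (Suc c) (Suc d)\<close>
    produces one copy of \<open>S (Suc c) d\<close> with shifted index and one without;
    \<open>S'\<close> links the two forms.\<close>
  show ?thesis
    using S' unfolding mult_2 Sd[of "Suc c"]
    unfolding S_def Sd[unfolded S_def] sum.atMost_Suc_shift
    by (simp add: algebra_simps sum.distrib)
qed

lemma box_sum_two:
  fixes G :: "nat \<Rightarrow> nat \<Rightarrow> int"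
  assumes G: "\<And>c d. 2 * G c d = 1 + (\<Sum>i\<le>c. \<Sum>j\<le>d. G i j)"
  shows "G c d = 2 ^ c * (\<Sum>i\<le>d. int (d choose i) * int ((c + i) choose i))"
proof -
  have two: "(2::int) \<noteq> 1" by simp
  have base: "G c 0 = 2 ^ c" for c
  proof (induction c)
    case 0
    then show ?case using G[of 0 0] by simp
  next
    case (Suc c)
    then show ?case using box_sum_diff_left[of 2 G c, OF two G] by simp
  qed
  define F where "F c d = 2 ^ c * (\<Sum>i\<le>d. int (d choose i) * int ((c + i) choose i))" for c d
  have "F c d = G c d"
  proof (rule box_sum_unique[OF two G])
    show "F c 0 = G c 0" for c by (simp add: F_def base)
    show "F 0 d = G d 0" for d
      using choose_row_sum[of d] by (simp add: F_def base flip: of_nat_sum)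
    show "2 * (F (Suc c) (Suc d) - F c (Suc d) - F (Suc c) d + F c d) = F (Suc c) (Suc d)" for c d
    proof -
      have "2 ^ Suc c * ((\<Sum>i\<le>Suc d. int (Suc d choose i) * int ((Suc c + i) choose i))
              + (\<Sum>i\<le>d. int (d choose i) * int ((c + i) choose i)))
          = 2 ^ Suc c * ((\<Sum>i\<le>Suc d. int (Suc d choose i) * int ((c + i) choose i))
              + 2 * (\<Sum>i\<le>d. int (d choose i) * int ((Suc c + i) choose i)))"
        using binomial_sum_recurrence[of d c] by simp
      then show ?thesis
        unfolding F_def power_Suc by (simp only: ring_distribs mult_2)
    qed
  qed
  then show ?thesis by (simp add: F_def)
qed

theorem theorem5:
  fixes p q r c d e :: nat
  assumes "prime p" and "prime q" and "prime r"
    and "p \<noteq> q" and "p \<noteq> r" and "q \<noteq> r"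
  shows "recursive_divisors (p ^ c) = 2 ^ c \<and>
         recursive_divisors (p ^ c * q ^ d) =
           2 ^ c * (\<Sum>i=0..d. (d choose i) * ((c + i) choose i)) \<and>
         int (recursive_divisors (p ^ c * q ^ d * r ^ e)) =
           (\<Sum>j=0..d. (-1) ^ j * int (d choose j) * int ((c + d - j) choose d)
                        * int (recursive_divisors (p ^ (c + d - j) * r ^ e)))"
proof -
  define A where "A c d e = int (recursive_divisors (p ^ c * q ^ d * r ^ e))" for c d e
  have pos: "p > 0" "q > 0" "r > 0"
    using assms by (auto intro: prime_gt_0_nat)
  have cop: "coprime p q" "coprime p r" "coprime q r"
    using assms by (auto intro: primes_coprime)
  have A: "2 * A c d e = 1 + (\<Sum>i\<le>c. \<Sum>j\<le>d. \<Sum>k\<le>e. A i j k)" for c d e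
  proof -
    have "(\<Sum>m | m dvd p ^ c * q ^ d * r ^ e. recursive_divisors m)
        = (\<Sum>i\<le>c. \<Sum>j\<le>d. \<Sum>k\<le>e. recursive_divisors (p ^ i * q ^ j * r ^ k))"
      using cop by (simp add: sum_divisors_mult_coprime sum_divisors_prime_power assms)
    then have "2 * recursive_divisors (p ^ c * q ^ d * r ^ e)
        = 1 + (\<Sum>i\<le>c. \<Sum>j\<le>d. \<Sum>k\<le>e. recursive_divisors (p ^ i * q ^ j * r ^ k))"
      using double_recursive_divisors[of "p ^ c * q ^ d * r ^ e"] pos by simp
    from arg_cong[OF this, of int] show ?thesis by (simp add: A_def)
  qed
  have A2: "A c d 0 = 2 ^ c * (\<Sum>i\<le>d. int (d choose i) * int ((c + i) choose i))" for c d
    by (rule box_sum_two[of "\<lambda>c d. A c d 0"]) (simp add: A)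
  have "int (recursive_divisors (p ^ c * q ^ d)) =
      int (2 ^ c * (\<Sum>i=0..d. (d choose i) * ((c + i) choose i)))" for d
    using A2[of c d] by (simp add: A_def atLeast0AtMost)
  \<comment> \<open>Kept general in \<open>d\<close>, since \<open>d = 0\<close> yields the value at
    \<open>p ^ c\<close>.\<close>
  then have two: "recursive_divisors (p ^ c * q ^ d) =
      2 ^ c * (\<Sum>i=0..d. (d choose i) * ((c + i) choose i))" for d
    using of_nat_eq_iff by blast

  define G where "G c d = Abs_fps (A c d)" for c d
  \<comment> \<open>Multiplication by the geometric series \<open>Z\<close> takes partial sums of
    coefficients, which expresses the sum over \<open>k \<le> e\<close> for all \<open>e\<close> at
    once.\<close>
  define Z :: "int fps" where "Z = Abs_fps (\<lambda>_. 1)"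
  have Z: "(1 - fps_X) * Z = 1"
    by (simp add: fps_eq_iff Z_def left_diff_distrib)
  have "2 * G c d = Z + (\<Sum>i\<le>c. \<Sum>j\<le>d. G i j) * Z" for c d
  proof (rule fps_ext)
    fix e
    have "fps_nth ((\<Sum>i\<le>c. \<Sum>j\<le>d. G i j) * Z) e = (\<Sum>i\<le>c. \<Sum>j\<le>d. \<Sum>k\<le>e. A i j k)"
      by (simp only: sum_distrib_right fps_sum_nth) (simp add: fps_mult_nth Z_def G_def atLeast0AtMost)
    then show "fps_nth (2 * G c d) e = fps_nth (Z + (\<Sum>i\<le>c. \<Sum>j\<le>d. G i j) * Z) e"
      using A[of c d e] by (simp only: mult_2 G_def fps_add_nth) (simp add: Z_def)
  qed
  then have "(1 - fps_X) * (2 * G c d)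
      = (1 - fps_X) * Z + (\<Sum>i\<le>c. \<Sum>j\<le>d. G i j) * ((1 - fps_X) * Z)" for c d
    by (simp only: distrib_left mult.left_commute)
  then have G: "(2 * (1 - fps_X)) * G c d = 1 + (\<Sum>i\<le>c. \<Sum>j\<le>d. G i j)" for c d
    unfolding Z mult_1_right mult.assoc by (simp only: mult.left_commute)
  have "fps_nth (2 * (1 - fps_X) :: int fps) 0 \<noteq> fps_nth 1 0"
    by simp
  then have v: "2 * (1 - fps_X) \<noteq> (1 :: int fps)"
    by metis
  have "A c d e = (\<Sum>i\<le>d. (-1) ^ (d + i) * int (d choose i) * int ((c + i) choose d) * A (c + i) 0 e)"
  proof -
    \<comment> \<open>The weights of \<open>box_sum_expansion\<close> are integers independent of
      \<open>v\<close>, hence constant series, so the identity can be read off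
      coefficientwise.\<close>
    have "G c d = (\<Sum>i\<le>d. fps_const ((-1) ^ (d + i) * int (d choose i) * int ((c + i) choose d))
        * G (c + i) 0)"
      by (subst box_sum_expansion[OF v G])
        (simp add: fps_of_nat flip: fps_const_mult fps_const_power fps_const_neg)
    from arg_cong[OF this, of "\<lambda>f. fps_nth f e"] show ?thesis
      by (simp add: fps_sum_nth G_def)
  qed
  \<comment> \<open>Substitute \<open>j = d - i\<close>; the sign agrees because
    \<open>d + i\<close> and \<open>d - i\<close> have the same parity.\<close>
  also have "\<dots> = (\<Sum>j\<le>d. (-1) ^ j * int (d choose j) * int ((c + d - j) choose d)
      * A (c + d - j) 0 e)"
    by (rule sum.reindex_bij_witness[of _ "\<lambda>j. d - j" "\<lambda>i. d - i"])
      (auto simp: binomial_symmetric[symmetric] minus_one_power_iff)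
  finally have three: "A c d e = \<dots>" .
  show ?thesis
    using two[of 0] two[of d] three by (simp add: A_def atLeast0AtMost)
qed

end
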